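(* Let $A\in\mathbb{R}^{m\times n}$ with columns $a_1,\dots,a_n$, $b\in\mathbb{R}^m$ and $\lambda>0$. Let $x^*$ be a solution of the Lasso problem $$\min_{x\in\mathbb{R}^n}\ \tfrac12\|Ax-b\|_2^2+\lambda\|x\|_1,$$ and define $I:=\operatorname{supp}(x^* )$ and $J:=\{i:|a_i^T(b-Ax^* )|=\lambda\}$. If $|J|=|I|+1$, then $x^*$ is the unique solution if and only if $A_J$ has full column rank.
   Context: For an index set $J\subseteq\{1,\dots,n\}$, $A_J$ is the submatrix of $A$ formed by the columns $a_i$, $i\in J$. $\operatorname{supp}(x)=\{i:x_i\ne 0\}$. *)

theory Defs
  imports "HOL-Analysis.Analysis"
begin

definition l1_norm :: "real ^ 'n \<Rightarrow> real" where
  "l1_norm x = (\<Sum>i\<in>UNIV. \<bar>x $ i\<bar>)"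

definition supp :: "real ^ 'n \<Rightarrow> 'n set" where
  "supp x = {i. x $ i \<noteq> 0}"

definition lasso_objective ::
    "real ^ 'n ^ 'm \<Rightarrow> real ^ 'm \<Rightarrow> real \<Rightarrow> real ^ 'n \<Rightarrow> real" where
  "lasso_objective A b l x = 1 / 2 * (norm (A *v x - b))\<^sup>2 + l * l1_norm x"

definition lasso_solution ::
    "real ^ 'n ^ 'm \<Rightarrow> real ^ 'm \<Rightarrow> real \<Rightarrow> real ^ 'n \<Rightarrow> bool" where
  "lasso_solution A b l x \<longleftrightarrow> is_arg_min (lasso_objective A b l) (\<lambda>_. True) x"

text \<open>
  The submatrix of A with column index set J has no type of the form
  \<^typ>\<open>real ^ 'k ^ 'm\<close>, since J is a set and not a type. Its rank is the dimension of
  its column space, and its number of columns is the cardinality of the index set J, so that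
  equal columns with different indices are counted separately. The lemma below checks the
  definition against \<^const>\<open>rank\<close> whenever a type enumerates J.
\<close>

definition rank_of_columns :: "real ^ 'n ^ 'm \<Rightarrow> 'n set \<Rightarrow> nat" where
  "rank_of_columns A J = dim {column i A | i. i \<in> J}"

definition full_column_rank_on :: "real ^ 'n ^ 'm \<Rightarrow> 'n set \<Rightarrow> bool" where
  "full_column_rank_on A J \<longleftrightarrow> rank_of_columns A J = card J"

lemma rank_of_columns_eq_rank:
  fixes A :: "real ^ 'n ^ 'm" and f :: "'k::finite \<Rightarrow> 'n"
  assumes "bij_betw f UNIV J"
  shows "rank (\<chi> i k. A $ i $ f k) = rank_of_columns A J"
    and "card J = CARD('k)"
proof -
  have J: "J = range f"
    using assms by (simp add: bij_betw_def)
  have col: "column k (\<chi> i k. A $ i $ f k) = column (f k) A" for k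
    by (simp add: column_def)
  have "columns (\<chi> i k. A $ i $ f k) = {column i A | i. i \<in> J}"
    unfolding columns_def col J by blast
  then show "rank (\<chi> i k. A $ i $ f k) = rank_of_columns A J"
    by (simp add: column_rank_def rank_of_columns_def)
  show "card J = CARD('k)"
    using bij_betw_same_card[OF assms] by simp
qed

end

theory Submission
  imports Defs
begin

text \<open>
  With \<open>r = b - A x\<^sup>*\<close> and \<open>g\<^sub>i = a\<^sub>i \<bullet> r\<close>, the optimality conditions \<open>\<bar>g\<^sub>i\<bar> \<le> \<lambda>\<close> and
  \<open>g\<^sub>i x\<^sup>*\<^sub>i = \<lambda> \<bar>x\<^sup>*\<^sub>i\<bar>\<close> turn the increment of the objective at \<open>y\<close> into
  \<open>\<parallel>A (y - x\<^sup>*)\<parallel>\<^sup>2 / 2 + (\<Sum>i. \<lambda> \<bar>y\<^sub>i\<bar> - g\<^sub>i y\<^sub>i)\<close>, a sum of nonnegative terms. Hence \<open>y\<close> is a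
  solution iff \<open>A y = A x\<^sup>*\<close> and \<open>\<lambda> \<bar>y\<^sub>i\<bar> = g\<^sub>i y\<^sub>i\<close> for all \<open>i\<close>; in particular its support lies
  in \<open>J\<close>, and uniqueness follows if \<open>A\<^sub>J\<close> is injective. Conversely, a nonzero kernel vector \<open>z\<close>
  supported in \<open>J\<close> may be negated so that its entry at the single index of \<open>J - I\<close> has the
  sign of \<open>g\<close>; then \<open>x\<^sup>* + t z\<close> is another solution for all small \<open>t > 0\<close>.
\<close>

section \<open>Full column rank as injectivity on a coordinate subspace\<close>

text \<open>The vectors supported in \<open>J\<close> form a subspace of dimension
  \<open>card J\<close>, and \<open>A\<close> maps it onto the span of the columns indexed by
  \<open>J\<close>. Injectivity there thus preserves the dimension; conversely, a rank of
  \<open>card J\<close> makes these columns distinct and independent.\<close>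

lemma full_column_rank_on_iff_kernel:
  fixes A :: "real ^ 'n ^ 'm"
  shows "full_column_rank_on A J \<longleftrightarrow> (\<forall>z. supp z \<subseteq> J \<longrightarrow> A *v z = 0 \<longrightarrow> z = 0)"
proof -
  define S :: "(real ^ 'n) set" where "S = {z. \<forall>i. i \<notin> J \<longrightarrow> z $ i = 0}"
  have S_supp: "z \<in> S \<longleftrightarrow> supp z \<subseteq> J" for z
    by (auto simp: S_def supp_def)
  have sub: "subspace S"
    by (auto simp: S_def subspace_def)
  have dimS: "dim S = card J"
    unfolding S_def dim_vec_eq[symmetric] by (rule dim_substandard_cart)
  have "(*v) A ` S = span {column i A | i. i \<in> J}"
  proof
    show "(*v) A ` S \<subseteq> span {column i A | i. i \<in> J}"
    proof safe
      fix z assume "z \<in> S"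
      have "z $ i *s column i A \<in> span {column i A | i. i \<in> J}" for i
      proof (cases "i \<in> J")
        case True
        then have "column i A \<in> span {column i A | i. i \<in> J}"
          by (intro span_base) auto
        then show ?thesis
          by (simp add: span_scale scalar_mult_eq_scaleR)
      next
        case False
        with \<open>z \<in> S\<close> show ?thesis
          by (simp add: S_def span_zero)
      qed
      then show "A *v z \<in> span {column i A | i. i \<in> J}"
        unfolding matrix_mult_sum by (intro span_sum)
    qed
    have "column i A \<in> (*v) A ` S" if "i \<in> J" for i
    proof
      show "column i A = A *v axis i 1"
        by (simp add: matrix_vector_mult_basis)
      show "axis i 1 \<in> S"
        using that by (auto simp: S_def axis_def)
    qed
    moreover have "subspace ((*v) A ` S)"
      using sub by (simp add: linear_subspace_image)
    ultimately show "span {column i A | i. i \<in> J} \<subseteq> (*v) A ` S"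
      by (intro span_minimal) auto
  qed
  then have rank: "rank_of_columns A J = dim ((*v) A ` S)"
    by (simp add: rank_of_columns_def dim_span)
  show ?thesis
  proof
    assume "full_column_rank_on A J"
    define K where "K = (\<lambda>i. column i A) ` J"
    have dimK: "dim K = card J"
      using \<open>full_column_rank_on A J\<close>
      by (simp add: K_def full_column_rank_on_def rank_of_columns_def Setcompr_eq_image)
    \<comment> \<open>Since \<open>dim K = card J\<close>, the chain
      \<open>dim K \<le> card K \<le> card J\<close> collapses. No column is repeated, and
      \<open>K\<close> is independent.\<close>
    have "dim K \<le> card K"
      by (simp add: K_def dim_le_card')
    moreover have "card K \<le> card J"
      by (simp add: K_def card_image_le)
    ultimately have cardK: "card K = card J"
      using dimK by simp
    then have inj: "inj_on (\<lambda>i. column i A) J"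
      by (simp add: K_def eq_card_imp_inj_on)
    have indep: "independent K"
      by (rule card_le_dim_spanning[of K K]) (simp_all add: span_superset dimK cardK, simp add: K_def)
    show "\<forall>z. supp z \<subseteq> J \<longrightarrow> A *v z = 0 \<longrightarrow> z = 0"
    proof (intro allI impI)
      fix z assume z: "supp z \<subseteq> J" "A *v z = 0"
      \<comment> \<open>Independence concerns coefficients on the set \<open>K\<close> of columns,
        so the entries of \<open>z\<close> are carried from indices to columns by inverting the
        injective indexing.\<close>
      define c where "c v = z $ the_inv_into J (\<lambda>i. column i A) v" for v
      have c: "c (column i A) = z $ i" if "i \<in> J" for i
        using the_inv_into_f_f[OF inj that] by (simp add: c_def)
      have "(\<Sum>v\<in>K. c v *\<^sub>R v) = (\<Sum>i\<in>J. z $ i *\<^sub>R column i A)"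
        by (simp add: K_def sum.reindex[OF inj] c)
      also have "\<dots> = A *v z"
        unfolding matrix_mult_sum scalar_mult_eq_scaleR
        using z(1) by (intro sum.mono_neutral_left) (auto simp: supp_def)
      finally have "(\<Sum>v\<in>K. c v *\<^sub>R v) = 0"
        using z(2) by simp
      then have "c v = 0" if "v \<in> K" for v
        using independentD[OF indep, of K c v] that by (simp add: K_def)
      then have "z $ i = 0" if "i \<in> J" for i
        using c that by (force simp: K_def)
      moreover have "z $ i = 0" if "i \<notin> J" for i
        using z(1) that by (auto simp: supp_def)
      ultimately show "z = 0"
        by (metis vec_eq_iff zero_index)
    qed
  next
    assume ker: "\<forall>z. supp z \<subseteq> J \<longrightarrow> A *v z = 0 \<longrightarrow> z = 0"
    have "inj_on ((*v) A) S"
    proof (rule inj_onI)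
      fix x y assume "x \<in> S" "y \<in> S" "A *v x = A *v y"
      then have "x - y \<in> S" "A *v (x - y) = 0"
        using sub by (auto simp: subspace_diff matrix_vector_mult_diff_distrib)
      with ker show "x = y"
        by (metis S_supp eq_iff_diff_eq_0)
    qed
    then have "dim ((*v) A ` S) = dim S"
      using sub by (intro dim_image_eq) (simp_all add: span_eq_iff[THEN iffD2])
    then show "full_column_rank_on A J"
      using rank dimS by (simp add: full_column_rank_on_def)
  qed
qed

section \<open>Expansion of the objective and optimality conditions\<close>

text \<open>The expansion of the square around \<open>x\<close> is exact, and writing
  \<open>A *v (y - x)\<close> as a combination of columns splits the linear part by
  coordinates.\<close>

lemma lasso_objective_diff:
  fixes A :: "real ^ 'n ^ 'm"
  shows "lasso_objective A b l y - lasso_objective A b l x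
    = 1 / 2 * (norm (A *v (y - x)))\<^sup>2
      + (\<Sum>i\<in>UNIV. l * \<bar>y $ i\<bar> - l * \<bar>x $ i\<bar>
           - (column i A \<bullet> (b - A *v x)) * (y $ i - x $ i))"
proof -
  define r where "r = b - A *v x"
  have residuals: "A *v y - b = A *v (y - x) - r" "A *v x - b = - r"
    by (simp_all add: r_def matrix_vector_mult_diff_distrib)
  have "(norm (A *v y - b))\<^sup>2
      = (norm (A *v (y - x)))\<^sup>2 - 2 * ((A *v (y - x)) \<bullet> r) + (norm (A *v x - b))\<^sup>2"
    unfolding residuals by (simp add: power2_norm_eq_inner inner_diff inner_commute)
  moreover have "(A *v (y - x)) \<bullet> r = (\<Sum>i\<in>UNIV. (column i A \<bullet> r) * (y $ i - x $ i))"
    unfolding matrix_mult_sum inner_sum_left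
    by (simp add: scalar_mult_eq_scaleR mult.commute)
  ultimately show ?thesis
    unfolding lasso_objective_def l1_norm_def sum_subtractf r_def[symmetric]
      sum_distrib_left[of l, symmetric]
    by algebra
qed

text \<open>Divide by \<open>s\<close> and let \<open>s\<close> tend to 0 from the right.\<close>

lemma nonneg_linear_coefficient:
  fixes c d :: real
  assumes "\<And>s. 0 < s \<Longrightarrow> s \<le> 1 \<Longrightarrow> 0 \<le> c * s\<^sup>2 + d * s"
  shows "0 \<le> d"
proof (rule tendsto_lowerbound)
  show "((\<lambda>s. c * s + d) \<longlongrightarrow> d) (at_right 0)"
    by (auto intro!: tendsto_eq_intros)
  have "0 \<le> c * s + d" if "0 < s" "s < 1" for s
  proof -
    have "0 \<le> s * (c * s + d)"
      using assms[of s] that by (simp add: algebra_simps power2_eq_square)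
    with \<open>0 < s\<close> show ?thesis
      by (simp add: zero_le_mult_iff)
  qed
  then show "\<forall>\<^sub>F s in at_right 0. 0 \<le> c * s + d"
    by (auto simp: eventually_at_right_field intro!: exI[of _ 1])
qed simp

text \<open>This is the subgradient inequality for \<open>l\<close> times the absolute value at
  \<open>x $ i\<close>. It follows by moving coordinate \<open>i\<close> a fraction \<open>s\<close>
  of the way to \<open>u\<close> and comparing first-order terms.\<close>

lemma lasso_solution_coordinate:
  fixes A :: "real ^ 'n ^ 'm"
  assumes "l \<ge> 0" and sol: "lasso_solution A b l x"
  shows "(column i A \<bullet> (b - A *v x)) * (u - x $ i) \<le> l * \<bar>u\<bar> - l * \<bar>x $ i\<bar>"
proof -
  define g where "g = column i A \<bullet> (b - A *v x)"
  define c where "c = 1 / 2 * (norm (column i A))\<^sup>2 * (u - x $ i)\<^sup>2"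
  define d where "d = l * \<bar>u\<bar> - l * \<bar>x $ i\<bar> - g * (u - x $ i)"
  have "0 \<le> d"
  proof (rule nonneg_linear_coefficient)
    fix s :: real assume s: "0 < s" "s \<le> 1"
    define t where "t = s * (u - x $ i)"
    define y where "y = x + t *\<^sub>R axis i 1"
    have y_nth: "y $ k = x $ k + (if k = i then t else 0)" for k
      by (simp add: y_def axis_def)
    have "0 \<le> lasso_objective A b l y - lasso_objective A b l x"
      using sol by (simp add: lasso_solution_def is_arg_min_linorder)
    also have "\<dots> = 1 / 2 * (norm (A *v (t *\<^sub>R axis i 1)))\<^sup>2
        + (\<Sum>k\<in>UNIV. if k = i then l * \<bar>x $ i + t\<bar> - l * \<bar>x $ i\<bar> - g * t else 0)"
      unfolding lasso_objective_diff
      by (intro arg_cong2[where f = "(+)"] sum.cong) (auto simp: y_nth g_def simp flip: y_def,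
        simp add: y_def)
    also have "\<dots> = c * s\<^sup>2 + (l * \<bar>x $ i + t\<bar> - l * \<bar>x $ i\<bar> - g * t)"
      by (simp add: matrix_vector_mult_scaleR matrix_vector_mult_basis c_def t_def
          power_mult_distrib)
    also have "\<dots> \<le> c * s\<^sup>2 + d * s"
    proof -
      \<comment> \<open>The moved coordinate is a convex combination of \<open>x $ i\<close> and
        \<open>u\<close>.\<close>
      have "\<bar>x $ i + t\<bar> = \<bar>(1 - s) * x $ i + s * u\<bar>"
        by (simp add: t_def algebra_simps)
      also have "\<dots> \<le> (1 - s) * \<bar>x $ i\<bar> + s * \<bar>u\<bar>"
        using abs_triangle_ineq[of "(1 - s) * x $ i" "s * u"] s by (simp add: abs_mult)
      finally have "l * \<bar>x $ i + t\<bar> \<le> l * ((1 - s) * \<bar>x $ i\<bar> + s * \<bar>u\<bar>)"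
        using \<open>l \<ge> 0\<close> by (rule mult_left_mono)
      then show ?thesis
        by (simp add: d_def t_def algebra_simps)
    qed
    finally show "0 \<le> c * s\<^sup>2 + d * s" .
  qed
  then show ?thesis
    by (simp add: d_def g_def)
qed

lemma lasso_solution_optimality:
  fixes A :: "real ^ 'n ^ 'm"
  assumes "l \<ge> 0" and "lasso_solution A b l x"
  shows "(column i A \<bullet> (b - A *v x)) * x $ i = l * \<bar>x $ i\<bar>"
    and "\<bar>column i A \<bullet> (b - A *v x)\<bar> \<le> l"
proof -
  note * = lasso_solution_coordinate[OF assms, of i]
  show eq: "(column i A \<bullet> (b - A *v x)) * x $ i = l * \<bar>x $ i\<bar>"
    \<comment> \<open>The points 0 and \<open>2 * x $ i\<close> lie symmetrically about
      \<open>x $ i\<close> and give the two opposite inequalities.\<close>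
    using *[of 0] *[of "2 * x $ i"] by (simp add: abs_mult)
  show "\<bar>column i A \<bullet> (b - A *v x)\<bar> \<le> l"
    using *[of 1] *[of "-1"] eq by (simp add: algebra_simps)
qed

lemma lasso_solution_iff:
  fixes A :: "real ^ 'n ^ 'm"
  assumes "l \<ge> 0" and sol: "lasso_solution A b l x"
  shows "lasso_solution A b l y \<longleftrightarrow>
    A *v (y - x) = 0 \<and> (\<forall>i. (column i A \<bullet> (b - A *v x)) * y $ i = l * \<bar>y $ i\<bar>)"
proof -
  define g where "g i = column i A \<bullet> (b - A *v x)" for i
  have gx: "g i * x $ i = l * \<bar>x $ i\<bar>" and g_le: "\<bar>g i\<bar> \<le> l" for i
    using lasso_solution_optimality[OF assms] by (simp_all add: g_def)
  have nonneg: "0 \<le> l * \<bar>y $ i\<bar> - g i * y $ i" for i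
  proof -
    have "g i * y $ i \<le> \<bar>g i\<bar> * \<bar>y $ i\<bar>"
      by (metis abs_ge_self abs_mult)
    also have "\<dots> \<le> l * \<bar>y $ i\<bar>"
      using g_le by (intro mult_right_mono) auto
    finally show ?thesis by simp
  qed
  have diff: "lasso_objective A b l y - lasso_objective A b l x
      = 1 / 2 * (norm (A *v (y - x)))\<^sup>2 + (\<Sum>i\<in>UNIV. l * \<bar>y $ i\<bar> - g i * y $ i)"
    unfolding lasso_objective_diff using gx
    by (simp add: g_def right_diff_distrib)
  have "lasso_solution A b l y \<longleftrightarrow> lasso_objective A b l y \<le> lasso_objective A b l x"
    using sol by (auto simp: lasso_solution_def is_arg_min_linorder intro: order_trans)
  also have "\<dots> \<longleftrightarrow>
      1 / 2 * (norm (A *v (y - x)))\<^sup>2 + (\<Sum>i\<in>UNIV. l * \<bar>y $ i\<bar> - g i * y $ i) = 0"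
  proof -
    have "0 \<le> (\<Sum>i\<in>UNIV. l * \<bar>y $ i\<bar> - g i * y $ i)"
      using nonneg by (intro sum_nonneg)
    moreover have "0 \<le> 1 / 2 * (norm (A *v (y - x)))\<^sup>2"
      by simp
    ultimately show ?thesis
      using diff by linarith
  qed
  also have "\<dots> \<longleftrightarrow> A *v (y - x) = 0 \<and> (\<forall>i. l * \<bar>y $ i\<bar> - g i * y $ i = 0)"
    using nonneg by (subst add_nonneg_eq_0_iff) (auto simp: sum_nonneg sum_nonneg_eq_0_iff)
  finally show ?thesis
    by (metis (no_types, lifting) g_def eq_iff_diff_eq_0)
qed

section \<open>Perturbation of a solution and the uniqueness criterion\<close>

text \<open>Each nonzero coordinate keeps its sign for small \<open>t\<close> by continuity, and
  finitely many such conditions hold simultaneously.\<close>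

lemma ex_small_step_preserving_signs:
  fixes x z :: "real ^ 'n"
  shows "\<exists>t>0. \<forall>i\<in>supp x. sgn ((x + t *\<^sub>R z) $ i) = sgn (x $ i)"
proof -
  have "\<forall>\<^sub>F t in at_right 0. sgn ((x + t *\<^sub>R z) $ i) = sgn (x $ i)" if "i \<in> supp x" for i
  proof -
    have lim: "((\<lambda>t. (x + t *\<^sub>R z) $ i) \<longlongrightarrow> x $ i) (at_right 0)"
      by (auto intro!: tendsto_eq_intros)
    have "x $ i \<noteq> 0"
      using that by (simp add: supp_def)
    then consider "x $ i > 0" | "x $ i < 0"
      by linarith
    then show ?thesis
    proof cases
      case 1
      with order_tendstoD(1)[OF lim, of 0] show ?thesis
        by (auto elim!: eventually_mono)
    next
      case 2
      with order_tendstoD(2)[OF lim, of 0] show ?thesis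
        by (auto elim!: eventually_mono)
    qed
  qed
  then have "\<forall>\<^sub>F t in at_right 0. \<forall>i\<in>supp x. sgn ((x + t *\<^sub>R z) $ i) = sgn (x $ i)"
    by (intro eventually_ball_finite) auto
  then have "\<forall>\<^sub>F t in at_right 0. t > 0 \<and> (\<forall>i\<in>supp x. sgn ((x + t *\<^sub>R z) $ i) = sgn (x $ i))"
    using eventually_at_right_less by (rule eventually_conj[rotated])
  then show ?thesis
    using eventually_happens' trivial_limit_at_right_real by blast
qed

theorem corollary2:
  fixes A :: "real ^ 'n ^ 'm" and b :: "real ^ 'm" and l :: real
    and xs :: "real ^ 'n" and I J :: "'n set"
  assumes "l > 0"
    and "lasso_solution A b l xs"
    and "I = supp xs"
    and "J = {i. \<bar>column i A \<bullet> (b - A *v xs)\<bar> = l}"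
    and "card J = card I + 1"
  shows "(\<forall>y. lasso_solution A b l y \<longrightarrow> y = xs) \<longleftrightarrow> full_column_rank_on A J"
proof -
  define g where "g i = column i A \<bullet> (b - A *v xs)" for i
  have J: "i \<in> J \<longleftrightarrow> \<bar>g i\<bar> = l" for i
    using assms(4) by (simp add: g_def)
  have sol_iff: "lasso_solution A b l y \<longleftrightarrow>
      A *v (y - xs) = 0 \<and> (\<forall>i. g i * y $ i = l * \<bar>y $ i\<bar>)" for y
    unfolding g_def using assms(1,2) by (intro lasso_solution_iff) auto
  have supp_J: "supp y \<subseteq> J" if "lasso_solution A b l y" for y
  proof
    fix i assume "i \<in> supp y"
    \<comment> \<open>Taking absolute values in the optimality equation lets the nonzero
      \<open>y $ i\<close> be cancelled.\<close>
    moreover have "\<bar>g i\<bar> * \<bar>y $ i\<bar> = l * \<bar>y $ i\<bar>"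
      using that \<open>l > 0\<close> sol_iff by (metis abs_mult abs_idempotent abs_of_pos)
    ultimately show "i \<in> J"
      by (simp add: J supp_def)
  qed
  have "I \<subseteq> J"
    using supp_J assms(2,3) by simp
  then have "card (J - I) = 1"
    using assms(5) by (simp add: card_Diff_subset)
  then obtain j where j: "J - I = {j}"
    by (rule card_1_singletonE)
  show ?thesis
    unfolding full_column_rank_on_iff_kernel
  proof (intro iffI allI impI)
    fix y
    assume ker: "\<forall>z. supp z \<subseteq> J \<longrightarrow> A *v z = 0 \<longrightarrow> z = 0"
      and y: "lasso_solution A b l y"
    have "supp (y - xs) \<subseteq> supp y \<union> supp xs"
      by (auto simp: supp_def)
    then have "supp (y - xs) \<subseteq> J"
      using supp_J y assms(2) by blast
    with ker y sol_iff have "y - xs = 0"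
      by blast
    then show "y = xs" by simp
  next
    fix z
    assume uniq: "\<forall>y. lasso_solution A b l y \<longrightarrow> y = xs"
      and z: "supp z \<subseteq> J" "A *v z = 0"
    \<comment> \<open>Only the index \<open>j\<close> imposes a sign condition on the direction, so
      one global sign change suffices.\<close>
    define w where "w = (if g j * z $ j \<ge> 0 then z else - z)"
    have w: "supp w \<subseteq> J" "A *v w = 0" "g j * w $ j \<ge> 0"
      using z by (auto simp: w_def supp_def vec.neg)
    obtain t where "t > 0"
      and sgn_t: "\<And>i. i \<in> I \<Longrightarrow> sgn ((xs + t *\<^sub>R w) $ i) = sgn (xs $ i)"
      using ex_small_step_preserving_signs assms(3) by blast
    define y where "y = xs + t *\<^sub>R w"
    have "g i * y $ i = l * \<bar>y $ i\<bar>" for i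
    proof -
      consider "i \<in> I" | "i = j" | "i \<notin> J"
        using j by blast
      then show ?thesis
      proof cases
        case 1
        \<comment> \<open>On \<open>I\<close> the equality at \<open>xs\<close> determines
          \<open>g i\<close> as \<open>l\<close> times the sign of \<open>xs $ i\<close>, and
          \<open>y\<close> keeps that sign.\<close>
        then have "xs $ i \<noteq> 0"
          using assms(3) by (simp add: supp_def)
        moreover have "g i * xs $ i = l * \<bar>xs $ i\<bar>"
          using assms(2) sol_iff by blast
        then have "g i * xs $ i = (l * sgn (xs $ i)) * xs $ i"
          by (simp add: abs_sgn mult_ac)
        ultimately have "g i = l * sgn (xs $ i)"
          by simp
        also have "\<dots> = l * sgn (y $ i)"
          using sgn_t 1 by (simp add: y_def)
        finally show ?thesis
          by (simp add: abs_sgn mult.commute mult.left_commute)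
      next
        case 2
        \<comment> \<open>As \<open>xs\<close> vanishes at \<open>j\<close>, the sign of
          \<open>y\<close> there is that of \<open>w\<close>, chosen to agree with
          \<open>g j\<close>.\<close>
        then have "y $ i = t * w $ i"
          using j assms(3) by (auto simp: y_def supp_def)
        then have "g i * y $ i \<ge> 0"
          using w(3) 2 \<open>t > 0\<close> by (simp add: mult.left_commute)
        then have "g i * y $ i = \<bar>g i\<bar> * \<bar>y $ i\<bar>"
          by (metis abs_mult abs_of_nonneg)
        moreover have "i \<in> J"
          using j 2 by blast
        ultimately show ?thesis
          by (simp add: J)
      next
        case 3
        then have "xs $ i = 0" "w $ i = 0"
          using w(1) \<open>I \<subseteq> J\<close> assms(3) by (auto simp: supp_def)
        then show ?thesis
          by (simp add: y_def)
      qed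
    qed
    moreover have "A *v (y - xs) = 0"
      using w(2) by (simp add: y_def matrix_vector_mult_scaleR)
    ultimately have "y = xs"
      using sol_iff uniq by blast
    then show "z = 0"
      using \<open>t > 0\<close> by (auto simp: y_def w_def split: if_splits)
  qed
qed

end
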